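(* Suppose there is a function $f:E\times\mathbb N\to E$ such that for all $\alpha\in E$, $d\in\mathbb N$ and all sequents $\Gamma$, $\vdash^\alpha_d\Gamma$ implies $\vdash^{f(\alpha,d)}_0\Gamma$. If $\mathsf{TI}_{\lhd}$ is a theorem of $\mathsf{PA}[X]$, then $(\mathbb N,\lhd)\lesssim(E\restriction\alpha,\prec)$ for some $\alpha\in E$. Consequently, $\mathsf{PA}[X]$ cannot prove $\mathsf{TI}_{\lhd}$ when $(E,\prec)\lesssim(\mathbb N,\lhd)$.
   Context: $\mathcal L_{\mathsf{PA}}$ is the first-order language with constant $0$, unary function $S$, binary functions $+,\times$ and binary relations $\leq,=$; $\mathcal L^X_{\mathsf{PA}}$ adds a unary relation symbol $X$. $\overline n$ is the $n$-th numeral. Formulas are in negation normal form: built from literals (prime formulas and their negations) by $\land,\lor,\forall,\exists$; the negation $\neg\varphi$ of a formula is defined via de Morgan's laws (swapping a prime formula with its negation, $\land$ with $\lor$, $\forall$ with $\exists$), and $\varphi\to\psi$ abbreviates $\neg\varphi\lor\psi$. "True" refers to the standard model $\mathbb N$. Rank: $\mathrm{rk}$ of a literal is $0$, $\mathrm{rk}(\varphi_0\land\varphi_1)=\mathrm{rk}(\varphi_0\lor\varphi_1)=\max(\mathrm{rk}\varphi_0,\mathrm{rk}\varphi_1)+1$, $\mathrm{rk}(\forall x\varphi)=\mathrm{rk}(\exists x\varphi)=\mathrm{rk}(\varphi)+1$. $\mathsf{PA}[X]$ is the $\mathcal L^X_{\mathsf{PA}}$-theory with the equality axioms (for the extended language),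 the axioms of Robinson arithmetic, and all induction axioms $\varphi[x/0]\land\forall x(\varphi\to\varphi[x/Sx])\to\forall x\varphi$ for $\mathcal L^X_{\mathsf{PA}}$-formulas $\varphi$. $(E,\prec)$ is a well order with a map $\alpha\mapsto\alpha+1$ satisfying $\alpha\prec\alpha+1$, and elements $0,\omega\in E$ with $0\prec\omega$ such that $\alpha\prec\omega$ implies $\alpha+1\prec\omega$. $E\restriction\alpha=\{\gamma\in E:\gamma\prec\alpha\}$. $x\lhd y$ is a fixed $\mathcal L_{\mathsf{PA}}$-formula with free variables $x,y$ only, defining a well order $\lhd$ on $\mathbb N$. $\forall y\lhd x.\varphi$ abbreviates $\forall y(y\lhd x\to\varphi)$; $\mathsf{Prog}_{\lhd}:\equiv\forall x(\forall y\lhd x.Xy\to Xx)$ and $\mathsf{TI}_{\lhd}:\equiv\mathsf{Prog}_{\lhd}\to\forall x.Xx$. For well orders, $(A,<_A)\lesssim(B,<_B)$ means there is $g:A\to B$ with $a<_A a'\Rightarrow g(a)<_B g(a')$. A sequent is a finite set of $\mathcal L^X_{\mathsf{PA}}$-sentences; $\Gamma,\varphi$ denotes $\Gamma\cup\{\varphi\}$. By recursion on $\alpha\in E$, $\vdash^\alpha_d\Gamma$ (for $d\in\mathbb N$) holds exactly if one of: (i) $\Gamma$ contains a true $\mathcal L_{\mathsf{PA}}$-literal, or formulas $Xs$ and $\neg Xt$ with closed terms $s,t$ of equal value; (ii) $\Gamma$ contains $\varphi_0\land\varphi_1$ (resp. $\varphi_0\lor\varphi_1$) and for every (resp. some) $i\in\{0,1\}$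 there are $\alpha(i)\prec\alpha$, $d(i)\leq d$, $\Delta_i\subseteq\Gamma,\varphi_i$ with $\vdash^{\alpha(i)}_{d(i)}\Delta_i$; (iii) $\Gamma$ contains $\forall x\varphi$ (resp. $\exists x\varphi$) and for every (resp. some) closed term $t$ there are $\alpha(t)\prec\alpha$, $d(t)\leq d$, $\Delta_t\subseteq\Gamma,\varphi[x/t]$ with $\vdash^{\alpha(t)}_{d(t)}\Delta_t$; (iv) $\Gamma$ contains $Xt$ and for every closed term $s$ with $s\lhd t$ (by value) there are $\alpha(s)\prec\alpha$, $d(s)\leq d$, $\Delta_s\subseteq\Gamma,Xs$ with $\vdash^{\alpha(s)}_{d(s)}\Delta_s$; (v) for some sentence $\varphi$ with $\mathrm{rk}(\varphi)<d$ and each $i\in\{0,1\}$ there are $\alpha(i)\prec\alpha$, $d(i)\leq d$ with $\vdash^{\alpha(0)}_{d(0)}\Delta_0$, $\vdash^{\alpha(1)}_{d(1)}\Delta_1$, $\Delta_0\subseteq\Gamma,\varphi$, $\Delta_1\subseteq\Gamma,\neg\varphi$. *)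

theory Defs
  imports Main
begin

section \<open>Syntax\<close>

datatype tm = Var nat | Zero | Succ tm | Add tm tm | Mul tm tm

datatype prime_fm = Eq tm tm | Le tm tm | InX tm

text \<open>Variables are de Bruijn indices: the quantifiers \<open>All\<close> and \<open>Ex\<close> bind index 0 of their body.\<close>

datatype fm =
    Pos prime_fm
  | Neg prime_fm
  | And fm fm
  | Or fm fm
  | All fm
  | Ex fm

primrec neg :: "fm \<Rightarrow> fm" where
  "neg (Pos p) = Neg p"
| "neg (Neg p) = Pos p"
| "neg (And \<phi> \<psi>) = Or (neg \<phi>) (neg \<psi>)"
| "neg (Or \<phi> \<psi>) = And (neg \<phi>) (neg \<psi>)"
| "neg (All \<phi>) = Ex (neg \<phi>)"
| "neg (Ex \<phi>) = All (neg \<phi>)"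

definition Imp :: "fm \<Rightarrow> fm \<Rightarrow> fm" where
  "Imp \<phi> \<psi> = Or (neg \<phi>) \<psi>"

definition Iff :: "fm \<Rightarrow> fm \<Rightarrow> fm" where
  "Iff \<phi> \<psi> = And (Imp \<phi> \<psi>) (Imp \<psi> \<phi>)"

primrec rk :: "fm \<Rightarrow> nat" where
  "rk (Pos p) = 0"
| "rk (Neg p) = 0"
| "rk (And \<phi> \<psi>) = max (rk \<phi>) (rk \<psi>) + 1"
| "rk (Or \<phi> \<psi>) = max (rk \<phi>) (rk \<psi>) + 1"
| "rk (All \<phi>) = rk \<phi> + 1"
| "rk (Ex \<phi>) = rk \<phi> + 1"

primrec fv_tm :: "tm \<Rightarrow> nat set" where
  "fv_tm (Var n) = {n}"
| "fv_tm Zero = {}"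
| "fv_tm (Succ t) = fv_tm t"
| "fv_tm (Add s t) = fv_tm s \<union> fv_tm t"
| "fv_tm (Mul s t) = fv_tm s \<union> fv_tm t"

primrec fv_prime :: "prime_fm \<Rightarrow> nat set" where
  "fv_prime (Eq s t) = fv_tm s \<union> fv_tm t"
| "fv_prime (Le s t) = fv_tm s \<union> fv_tm t"
| "fv_prime (InX t) = fv_tm t"

primrec fv :: "fm \<Rightarrow> nat set" where
  "fv (Pos p) = fv_prime p"
| "fv (Neg p) = fv_prime p"
| "fv (And \<phi> \<psi>) = fv \<phi> \<union> fv \<psi>"
| "fv (Or \<phi> \<psi>) = fv \<phi> \<union> fv \<psi>"
| "fv (All \<phi>) = {n. Suc n \<in> fv \<phi>}"
| "fv (Ex \<phi>) = {n. Suc n \<in> fv \<phi>}"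

definition closed_tm :: "tm \<Rightarrow> bool" where
  "closed_tm t \<longleftrightarrow> fv_tm t = {}"

definition sentence :: "fm \<Rightarrow> bool" where
  "sentence \<phi> \<longleftrightarrow> fv \<phi> = {}"

text \<open>\<open>PA_fm \<phi>\<close>: the formula \<open>\<phi>\<close> belongs to the language without the relation symbol \<open>X\<close>.\<close>

primrec PA_prime :: "prime_fm \<Rightarrow> bool" where
  "PA_prime (Eq s t) = True"
| "PA_prime (Le s t) = True"
| "PA_prime (InX t) = False"

primrec PA_fm :: "fm \<Rightarrow> bool" where
  "PA_fm (Pos p) = PA_prime p"
| "PA_fm (Neg p) = PA_prime p"
| "PA_fm (And \<phi> \<psi>) = (PA_fm \<phi> \<and> PA_fm \<psi>)"
| "PA_fm (Or \<phi> \<psi>) = (PA_fm \<phi> \<and> PA_fm \<psi>)"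
| "PA_fm (All \<phi>) = PA_fm \<phi>"
| "PA_fm (Ex \<phi>) = PA_fm \<phi>"

primrec subst_tm :: "(nat \<Rightarrow> tm) \<Rightarrow> tm \<Rightarrow> tm" where
  "subst_tm \<sigma> (Var n) = \<sigma> n"
| "subst_tm \<sigma> Zero = Zero"
| "subst_tm \<sigma> (Succ t) = Succ (subst_tm \<sigma> t)"
| "subst_tm \<sigma> (Add s t) = Add (subst_tm \<sigma> s) (subst_tm \<sigma> t)"
| "subst_tm \<sigma> (Mul s t) = Mul (subst_tm \<sigma> s) (subst_tm \<sigma> t)"

primrec subst_prime :: "(nat \<Rightarrow> tm) \<Rightarrow> prime_fm \<Rightarrow> prime_fm" where
  "subst_prime \<sigma> (Eq s t) = Eq (subst_tm \<sigma> s) (subst_tm \<sigma> t)"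
| "subst_prime \<sigma> (Le s t) = Le (subst_tm \<sigma> s) (subst_tm \<sigma> t)"
| "subst_prime \<sigma> (InX t) = InX (subst_tm \<sigma> t)"

definition up :: "(nat \<Rightarrow> tm) \<Rightarrow> nat \<Rightarrow> tm" where
  "up \<sigma> = case_nat (Var 0) (\<lambda>n. subst_tm (\<lambda>k. Var (Suc k)) (\<sigma> n))"

primrec subst :: "(nat \<Rightarrow> tm) \<Rightarrow> fm \<Rightarrow> fm" where
  "subst \<sigma> (Pos p) = Pos (subst_prime \<sigma> p)"
| "subst \<sigma> (Neg p) = Neg (subst_prime \<sigma> p)"
| "subst \<sigma> (And \<phi> \<psi>) = And (subst \<sigma> \<phi>) (subst \<sigma> \<psi>)"
| "subst \<sigma> (Or \<phi> \<psi>) = Or (subst \<sigma> \<phi>) (subst \<sigma> \<psi>)"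
| "subst \<sigma> (All \<phi>) = All (subst (up \<sigma>) \<phi>)"
| "subst \<sigma> (Ex \<phi>) = Ex (subst (up \<sigma>) \<phi>)"

text \<open>\<open>inst \<phi> t\<close> is \<open>\<phi>[x/t]\<close>, where \<open>x\<close> is index 0 of \<open>\<phi>\<close>; the remaining indices are lowered by
  one, as the binder of \<open>x\<close> disappears.\<close>

definition inst :: "fm \<Rightarrow> tm \<Rightarrow> fm" where
  "inst \<phi> t = subst (case_nat t Var) \<phi>"

definition shift :: "fm \<Rightarrow> fm" where
  "shift \<phi> = subst (\<lambda>n. Var (Suc n)) \<phi>"


section \<open>The standard model\<close>

primrec eval :: "(nat \<Rightarrow> nat) \<Rightarrow> tm \<Rightarrow> nat" where
  "eval e (Var n) = e n"
| "eval e Zero = 0"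
| "eval e (Succ t) = Suc (eval e t)"
| "eval e (Add s t) = eval e s + eval e t"
| "eval e (Mul s t) = eval e s * eval e t"

text \<open>The set \<open>A\<close> interprets \<open>X\<close>; it is irrelevant for formulas satisfying \<open>PA_fm\<close>.\<close>

primrec sat_prime :: "nat set \<Rightarrow> (nat \<Rightarrow> nat) \<Rightarrow> prime_fm \<Rightarrow> bool" where
  "sat_prime A e (Eq s t) = (eval e s = eval e t)"
| "sat_prime A e (Le s t) = (eval e s \<le> eval e t)"
| "sat_prime A e (InX t) = (eval e t \<in> A)"

primrec sat :: "nat set \<Rightarrow> (nat \<Rightarrow> nat) \<Rightarrow> fm \<Rightarrow> bool" where
  "sat A e (Pos p) = sat_prime A e p"
| "sat A e (Neg p) = (\<not> sat_prime A e p)"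
| "sat A e (And \<phi> \<psi>) = (sat A e \<phi> \<and> sat A e \<psi>)"
| "sat A e (Or \<phi> \<psi>) = (sat A e \<phi> \<or> sat A e \<psi>)"
| "sat A e (All \<phi>) = (\<forall>n. sat A (case_nat n e) \<phi>)"
| "sat A e (Ex \<phi>) = (\<exists>n. sat A (case_nat n e) \<phi>)"

definition val :: "tm \<Rightarrow> nat" where
  "val t = eval (\<lambda>_. 0) t"

definition true_PA_literal :: "fm \<Rightarrow> bool" where
  "true_PA_literal \<phi> \<longleftrightarrow>
     (\<exists>p. \<phi> = Pos p \<or> \<phi> = Neg p) \<and> sentence \<phi> \<and> PA_fm \<phi> \<and> sat {} (\<lambda>_. 0) \<phi>"


section \<open>First-order derivability and \<open>PA[X]\<close>\<close>

text \<open>Classical first-order logic as a one-sided (Tait) sequent calculus with cut over a theory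
  \<open>T\<close>; a sequent is read disjunctively. Equality is handled by the axioms of \<open>T\<close>. Axioms with free
  variables count as their universal closures: in rule \<open>all\<close> the side formulas are
  shifted (eigenvariable condition), while \<open>T\<close> is not.\<close>

inductive fol_derivable :: "fm set \<Rightarrow> fm set \<Rightarrow> bool" for T :: "fm set" where
  lit: "finite \<Gamma> \<Longrightarrow> Pos p \<in> \<Gamma> \<Longrightarrow> Neg p \<in> \<Gamma> \<Longrightarrow> fol_derivable T \<Gamma>"
| ax: "finite \<Gamma> \<Longrightarrow> \<phi> \<in> T \<Longrightarrow> \<phi> \<in> \<Gamma> \<Longrightarrow> fol_derivable T \<Gamma>"
| conj: "And \<phi> \<psi> \<in> \<Gamma> \<Longrightarrow> fol_derivable T (insert \<phi> \<Gamma>) \<Longrightarrow> fol_derivable T (insert \<psi> \<Gamma>)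
    \<Longrightarrow> fol_derivable T \<Gamma>"
| disj: "Or \<phi> \<psi> \<in> \<Gamma> \<Longrightarrow> fol_derivable T (insert \<phi> (insert \<psi> \<Gamma>)) \<Longrightarrow> fol_derivable T \<Gamma>"
| all: "All \<phi> \<in> \<Gamma> \<Longrightarrow> fol_derivable T (insert \<phi> (shift ` \<Gamma>)) \<Longrightarrow> fol_derivable T \<Gamma>"
| ex: "Ex \<phi> \<in> \<Gamma> \<Longrightarrow> fol_derivable T (insert (inst \<phi> t) \<Gamma>) \<Longrightarrow> fol_derivable T \<Gamma>"
| cut: "fol_derivable T (insert \<phi> \<Gamma>) \<Longrightarrow> fol_derivable T (insert (neg \<phi>) \<Gamma>)
    \<Longrightarrow> fol_derivable T \<Gamma>"

definition provable :: "fm set \<Rightarrow> fm \<Rightarrow> bool" where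
  "provable T \<phi> \<longleftrightarrow> fol_derivable T {\<phi>}"

abbreviation v0 :: tm where "v0 \<equiv> Var 0"
abbreviation v1 :: tm where "v1 \<equiv> Var 1"
abbreviation v2 :: tm where "v2 \<equiv> Var 2"
abbreviation v3 :: tm where "v3 \<equiv> Var 3"

definition equality_axioms :: "fm set" where
  "equality_axioms =
    {Pos (Eq v0 v0),
     Imp (Pos (Eq v0 v1)) (Pos (Eq v1 v0)),
     Imp (And (Pos (Eq v0 v1)) (Pos (Eq v1 v2))) (Pos (Eq v0 v2)),
     Imp (Pos (Eq v0 v1)) (Pos (Eq (Succ v0) (Succ v1))),
     Imp (And (Pos (Eq v0 v1)) (Pos (Eq v2 v3))) (Pos (Eq (Add v0 v2) (Add v1 v3))),
     Imp (And (Pos (Eq v0 v1)) (Pos (Eq v2 v3))) (Pos (Eq (Mul v0 v2) (Mul v1 v3))),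
     Imp (And (Pos (Eq v0 v1)) (Pos (Eq v2 v3))) (Imp (Pos (Le v0 v2)) (Pos (Le v1 v3))),
     Imp (Pos (Eq v0 v1)) (Imp (Pos (InX v0)) (Pos (InX v1)))}"

text \<open>In the last axiom, \<open>Ex\<close> binds \<open>v0\<close>, so it says \<open>x \<le> y \<longleftrightarrow> (\<exists>z. z + x = y)\<close> for the
  variables \<open>x\<close>, \<open>y\<close> with indices 0 and 1 outside the quantifier; similarly for the third.\<close>

definition robinson_axioms :: "fm set" where
  "robinson_axioms =
    {Neg (Eq (Succ v0) Zero),
     Imp (Pos (Eq (Succ v0) (Succ v1))) (Pos (Eq v0 v1)),
     Imp (Neg (Eq v0 Zero)) (Ex (Pos (Eq v1 (Succ v0)))),
     Pos (Eq (Add v0 Zero) v0),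
     Pos (Eq (Add v0 (Succ v1)) (Succ (Add v0 v1))),
     Pos (Eq (Mul v0 Zero) Zero),
     Pos (Eq (Mul v0 (Succ v1)) (Add (Mul v0 v1) v0)),
     Iff (Pos (Le v0 v1)) (Ex (Pos (Eq (Add v0 v1) v2)))}"

text \<open>The induction variable is index 0 of \<open>\<phi>\<close>; all other free variables are parameters. The
  substitution \<open>Var(0 := Succ v0)\<close> takes place under the quantifier and yields \<open>\<phi>[x/Sx]\<close>.\<close>

definition induction_axiom :: "fm \<Rightarrow> fm" where
  "induction_axiom \<phi> =
    Imp (And (inst \<phi> Zero) (All (Imp \<phi> (subst (Var(0 := Succ v0)) \<phi>)))) (All \<phi>)"

definition PAX :: "fm set" where
  "PAX = equality_axioms \<union> robinson_axioms \<union> range induction_axiom"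


section \<open>Well orders and transfinite induction\<close>

definition strict_well_order :: "('a \<Rightarrow> 'a \<Rightarrow> bool) \<Rightarrow> bool" where
  "strict_well_order R \<longleftrightarrow> irreflp R \<and> transp R \<and> totalp R \<and> wfp R"

definition order_embeds ::
  "'a set \<Rightarrow> ('a \<Rightarrow> 'a \<Rightarrow> bool) \<Rightarrow> 'b set \<Rightarrow> ('b \<Rightarrow> 'b \<Rightarrow> bool) \<Rightarrow> bool" where
  "order_embeds A R B S \<longleftrightarrow> (\<exists>g. g ` A \<subseteq> B \<and> monotone_on A R S g)"

text \<open>A formula \<open>L\<close> with free variables among the indices 0 and 1 is read as
  \<open>v0 \<lhd> v1\<close>.\<close>

definition defined_rel :: "fm \<Rightarrow> nat \<Rightarrow> nat \<Rightarrow> bool" where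
  "defined_rel L m n \<longleftrightarrow> sat {} (case_nat m (\<lambda>_. n)) L"

text \<open>Below the two quantifiers \<open>\<forall>x \<forall>y\<close>, the variable \<open>y\<close> has index 0 and \<open>x\<close> has index 1, so
  \<open>L\<close> itself expresses \<open>y \<lhd> x\<close> there.\<close>

definition Prog :: "fm \<Rightarrow> fm" where
  "Prog L = All (Imp (All (Imp L (Pos (InX v0)))) (Pos (InX v0)))"

definition TI :: "fm \<Rightarrow> fm" where
  "TI L = Imp (Prog L) (All (Pos (InX v0)))"


section \<open>The infinitary calculus\<close>

definition sequent :: "fm set \<Rightarrow> bool" where
  "sequent \<Gamma> \<longleftrightarrow> finite \<Gamma> \<and> (\<forall>\<phi>\<in>\<Gamma>. sentence \<phi>)"

text \<open>\<open>infd R \<alpha> d \<Gamma>\<close> stands for the infinitary derivability of \<open>\<Gamma>\<close> with height \<open>\<alpha>\<close> and cut rank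
  \<open>d\<close>, where \<open>R\<close> is the relation on the natural numbers used in rule \<open>prog\<close>. As heights decrease
  along a well order, the least predicate closed under the rules is the only one that
  satisfies the equivalence \<open>infd.simps\<close>, i.e. the one given by recursion on \<open>\<alpha>\<close>.\<close>

inductive infd :: "(nat \<Rightarrow> nat \<Rightarrow> bool) \<Rightarrow> 'e::wellorder \<Rightarrow> nat \<Rightarrow> fm set \<Rightarrow> bool"
  for R :: "nat \<Rightarrow> nat \<Rightarrow> bool" where
  true_lit:
    "sequent \<Gamma> \<Longrightarrow> \<phi> \<in> \<Gamma> \<Longrightarrow> true_PA_literal \<phi> \<Longrightarrow> infd R \<alpha> d \<Gamma>"
| X_lit:
    "sequent \<Gamma> \<Longrightarrow> Pos (InX s) \<in> \<Gamma> \<Longrightarrow> Neg (InX t) \<in> \<Gamma> \<Longrightarrow> val s = val t \<Longrightarrow> infd R \<alpha> d \<Gamma>"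
| conj:
    "sequent \<Gamma> \<Longrightarrow> And \<phi>\<^sub>0 \<phi>\<^sub>1 \<in> \<Gamma> \<Longrightarrow>
     \<forall>\<psi>\<in>{\<phi>\<^sub>0, \<phi>\<^sub>1}. \<exists>\<beta><\<alpha>. \<exists>e\<le>d. \<exists>\<Delta>. \<Delta> \<subseteq> insert \<psi> \<Gamma> \<and> infd R \<beta> e \<Delta> \<Longrightarrow>
     infd R \<alpha> d \<Gamma>"
| disj:
    "sequent \<Gamma> \<Longrightarrow> Or \<phi>\<^sub>0 \<phi>\<^sub>1 \<in> \<Gamma> \<Longrightarrow>
     \<exists>\<psi>\<in>{\<phi>\<^sub>0, \<phi>\<^sub>1}. \<exists>\<beta><\<alpha>. \<exists>e\<le>d. \<exists>\<Delta>. \<Delta> \<subseteq> insert \<psi> \<Gamma> \<and> infd R \<beta> e \<Delta> \<Longrightarrow>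
     infd R \<alpha> d \<Gamma>"
| all:
    "sequent \<Gamma> \<Longrightarrow> All \<phi> \<in> \<Gamma> \<Longrightarrow>
     \<forall>t. closed_tm t \<longrightarrow>
       (\<exists>\<beta><\<alpha>. \<exists>e\<le>d. \<exists>\<Delta>. \<Delta> \<subseteq> insert (inst \<phi> t) \<Gamma> \<and> infd R \<beta> e \<Delta>) \<Longrightarrow>
     infd R \<alpha> d \<Gamma>"
| ex:
    "sequent \<Gamma> \<Longrightarrow> Ex \<phi> \<in> \<Gamma> \<Longrightarrow>
     \<exists>t. closed_tm t \<and>
       (\<exists>\<beta><\<alpha>. \<exists>e\<le>d. \<exists>\<Delta>. \<Delta> \<subseteq> insert (inst \<phi> t) \<Gamma> \<and> infd R \<beta> e \<Delta>) \<Longrightarrow>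
     infd R \<alpha> d \<Gamma>"
| prog:
    "sequent \<Gamma> \<Longrightarrow> Pos (InX t) \<in> \<Gamma> \<Longrightarrow>
     \<forall>s. closed_tm s \<and> R (val s) (val t) \<longrightarrow>
       (\<exists>\<beta><\<alpha>. \<exists>e\<le>d. \<exists>\<Delta>. \<Delta> \<subseteq> insert (Pos (InX s)) \<Gamma> \<and> infd R \<beta> e \<Delta>) \<Longrightarrow>
     infd R \<alpha> d \<Gamma>"
| cut:
    "sequent \<Gamma> \<Longrightarrow> sentence \<phi> \<Longrightarrow> rk \<phi> < d \<Longrightarrow>
     \<forall>\<psi>\<in>{\<phi>, neg \<phi>}. \<exists>\<beta><\<alpha>. \<exists>e\<le>d. \<exists>\<Delta>. \<Delta> \<subseteq> insert \<psi> \<Gamma> \<and> infd R \<beta> e \<Delta> \<Longrightarrow>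
     infd R \<alpha> d \<Gamma>"

end

theory Submission
  imports Defs
begin

text \<open>A \<open>PA[X]\<close>-proof translates, uniformly in the closed terms substituted for its free
  variables, into an infinitary derivation of height \<open>\<omega> + k\<close> and finite cut rank. Rule \<open>prog\<close> proves
  progressivity, so a \<open>PA[X]\<close>-proof of transfinite induction yields derivations of all \<open>X t\<close> with
  one common height, and cut elimination makes them cut-free with a common height \<open>\<beta>\<close>. A cut-free
  derivation of a set of formulas \<open>X t\<close> can only use \<open>prog\<close>. Hence the predecessors of the value of
  one of the \<open>t\<close> embed into the elements below the height, and assigning to each number the least
  such bound on its predecessors embeds all numbers into the elements below \<open>\<beta> + 1\<close>.\<close>

section \<open>Substitution\<close>

lemma subst_tm_comp: "subst_tm \<sigma> (subst_tm \<tau> t) = subst_tm (\<lambda>n. subst_tm \<sigma> (\<tau> n)) t"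
  by (induction t) auto

lemma up_comp: "(\<lambda>n. subst_tm (up \<sigma>) (up \<tau> n)) = up (\<lambda>n. subst_tm \<sigma> (\<tau> n))"
  by (auto simp: up_def subst_tm_comp fun_eq_iff split: nat.split)

lemma subst_comp: "subst \<sigma> (subst \<tau> \<phi>) = subst (\<lambda>n. subst_tm \<sigma> (\<tau> n)) \<phi>"
proof (induction \<phi> arbitrary: \<sigma> \<tau>)
  case (Pos p) then show ?case by (cases p) (auto simp: subst_tm_comp)
next
  case (Neg p) then show ?case by (cases p) (auto simp: subst_tm_comp)
qed (auto simp: up_comp)

lemma subst_tm_Var [simp]: "subst_tm Var t = t"
  by (induction t) auto

lemma up_Var [simp]: "up Var = Var"
  by (auto simp: up_def fun_eq_iff split: nat.split)

lemma subst_Var [simp]: "subst Var \<phi> = \<phi>"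
proof (induction \<phi>)
  case (Pos p) then show ?case by (cases p) auto
next
  case (Neg p) then show ?case by (cases p) auto
qed auto

lemma subst_tm_cong: "(\<And>n. n \<in> fv_tm t \<Longrightarrow> \<sigma> n = \<tau> n) \<Longrightarrow> subst_tm \<sigma> t = subst_tm \<tau> t"
  by (induction t) auto

lemma subst_cong: "(\<And>n. n \<in> fv \<phi> \<Longrightarrow> \<sigma> n = \<tau> n) \<Longrightarrow> subst \<sigma> \<phi> = subst \<tau> \<phi>"
proof (induction \<phi> arbitrary: \<sigma> \<tau>)
  case (Pos p) then show ?case by (cases p) (auto intro!: subst_tm_cong)
next
  case (Neg p) then show ?case by (cases p) (auto intro!: subst_tm_cong)
next
  case (And \<phi> \<psi>) then show ?case by (metis UnCI fv.simps(3) subst.simps(3))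
next
  case (Or \<phi> \<psi>) then show ?case by (metis UnCI fv.simps(4) subst.simps(4))
next
  case (All \<phi>)
  have "subst (up \<sigma>) \<phi> = subst (up \<tau>) \<phi>"
    by (rule All.IH) (auto simp: up_def All.prems split: nat.split)
  then show ?case by simp
next
  case (Ex \<phi>)
  have "subst (up \<sigma>) \<phi> = subst (up \<tau>) \<phi>"
    by (rule Ex.IH) (auto simp: up_def Ex.prems split: nat.split)
  then show ?case by simp
qed

lemma subst_neg [simp]: "subst \<sigma> (neg \<phi>) = neg (subst \<sigma> \<phi>)"
  by (induction \<phi> arbitrary: \<sigma>) auto

lemma neg_neg [simp]: "neg (neg \<phi>) = \<phi>"
  by (induction \<phi>) auto

lemma rk_subst [simp]: "rk (subst \<sigma> \<phi>) = rk \<phi>"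
  by (induction \<phi> arbitrary: \<sigma>) auto

lemma rk_inst [simp]: "rk (inst \<phi> t) = rk \<phi>"
  by (simp add: inst_def)

lemma fv_neg [simp]: "fv (neg \<phi>) = fv \<phi>"
  by (induction \<phi>) auto

lemma sentence_neg [simp]: "sentence (neg \<phi>) = sentence \<phi>"
  by (simp add: sentence_def)

lemma PA_fm_subst [simp]: "PA_fm (subst \<sigma> \<phi>) = PA_fm \<phi>"
proof (induction \<phi> arbitrary: \<sigma>)
  case (Pos p) then show ?case by (cases p) auto
next
  case (Neg p) then show ?case by (cases p) auto
qed auto

lemma fv_subst_tm: "fv_tm (subst_tm \<sigma> t) = (\<Union>n\<in>fv_tm t. fv_tm (\<sigma> n))"
  by (induction t) auto

lemma fv_up: "Suc m \<in> fv_tm (up \<sigma> n) \<longleftrightarrow> (\<exists>k. n = Suc k \<and> m \<in> fv_tm (\<sigma> k))"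
  by (auto simp: up_def fv_subst_tm split: nat.split)

lemma fv_subst: "fv (subst \<sigma> \<phi>) = (\<Union>n\<in>fv \<phi>. fv_tm (\<sigma> n))"
proof (induction \<phi> arbitrary: \<sigma>)
  case (Pos p) then show ?case by (cases p) (auto simp: fv_subst_tm)
next
  case (Neg p) then show ?case by (cases p) (auto simp: fv_subst_tm)
next
  case (All \<phi>) show ?case by (force simp: All fv_up)
next
  case (Ex \<phi>) show ?case by (force simp: Ex fv_up)
qed auto

section \<open>Substitution and truth in the standard model\<close>

lemma eval_subst_tm: "eval e (subst_tm \<sigma> t) = eval (\<lambda>n. eval e (\<sigma> n)) t"
  by (induction t) auto

lemma eval_up: "(\<lambda>k. eval (case_nat n e) (up \<sigma> k)) = case_nat n (\<lambda>k. eval e (\<sigma> k))"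
  by (auto simp: up_def eval_subst_tm fun_eq_iff split: nat.split)

lemma sat_subst: "sat A e (subst \<sigma> \<phi>) = sat A (\<lambda>n. eval e (\<sigma> n)) \<phi>"
proof (induction \<phi> arbitrary: e \<sigma>)
  case (Pos p) then show ?case by (cases p) (auto simp: eval_subst_tm)
next
  case (Neg p) then show ?case by (cases p) (auto simp: eval_subst_tm)
qed (auto simp: eval_up)

lemma eval_cong: "(\<And>n. n \<in> fv_tm t \<Longrightarrow> e n = e' n) \<Longrightarrow> eval e t = eval e' t"
  by (induction t) auto

lemma sat_cong: "(\<And>n. n \<in> fv \<phi> \<Longrightarrow> e n = e' n) \<Longrightarrow> sat A e \<phi> = sat A e' \<phi>"
proof (induction \<phi> arbitrary: e e')
  case (Pos p) then show ?case by (cases p) (auto cong: eval_cong)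
next
  case (Neg p) then show ?case by (cases p) (auto cong: eval_cong)
next
  case (And \<phi> \<psi>) then show ?case by (metis UnCI fv.simps(3) sat.simps(3))
next
  case (Or \<phi> \<psi>) then show ?case by (metis UnCI fv.simps(4) sat.simps(4))
next
  case (All \<phi>)
  have "sat A (case_nat n e) \<phi> = sat A (case_nat n e') \<phi>" for n
    by (rule All.IH) (auto simp: All.prems split: nat.split)
  then show ?case by simp
next
  case (Ex \<phi>)
  have "sat A (case_nat n e) \<phi> = sat A (case_nat n e') \<phi>" for n
    by (rule Ex.IH) (auto simp: Ex.prems split: nat.split)
  then show ?case by simp
qed

section \<open>Closed instances of formulas, and numerals\<close>

definition closed_sub :: "(nat \<Rightarrow> tm) \<Rightarrow> bool" where
  "closed_sub \<sigma> \<longleftrightarrow> (\<forall>n. closed_tm (\<sigma> n))"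

lemma closed_sub_case_nat [simp]: "closed_tm t \<Longrightarrow> closed_sub \<sigma> \<Longrightarrow> closed_sub (case_nat t \<sigma>)"
  by (auto simp: closed_sub_def split: nat.split)

lemma sentence_subst [simp]: "closed_sub \<sigma> \<Longrightarrow> sentence (subst \<sigma> \<phi>)"
  by (auto simp: sentence_def fv_subst closed_sub_def closed_tm_def)

lemma closed_subst_tm [simp]: "closed_sub \<sigma> \<Longrightarrow> closed_tm (subst_tm \<sigma> t)"
  by (auto simp: closed_tm_def fv_subst_tm closed_sub_def)

lemma closed_Zero [simp]: "closed_tm Zero"
  by (simp add: closed_tm_def)

lemma closed_Succ [simp]: "closed_tm (Succ t) = closed_tm t"
  by (simp add: closed_tm_def)

lemma sentence_inst: "closed_tm t \<Longrightarrow> sentence (All \<phi>) \<Longrightarrow> sentence (inst \<phi> t)"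
  by (force simp: sentence_def inst_def fv_subst closed_tm_def split: nat.splits)

lemma sentence_InX [simp]: "sentence (Pos (InX t)) = closed_tm t" "sentence (Neg (InX t)) = closed_tm t"
  by (auto simp: sentence_def closed_tm_def)

text \<open>\<open>up \<sigma>\<close> lifts the values of \<open>\<sigma>\<close> past the binder
  and \<open>inst\<close> lowers them again, so the quantifier rules act on an instance by extending
  its substitution.\<close>

lemma inst_subst_up: "inst (subst (up \<sigma>) \<phi>) t = subst (case_nat t \<sigma>) \<phi>"
proof -
  have "(\<lambda>n. subst_tm (case_nat t Var) (up \<sigma> n)) = case_nat t \<sigma>"
    by (auto simp: up_def subst_tm_comp fun_eq_iff split: nat.split)
  then show ?thesis by (simp add: inst_def subst_comp)
qed

lemma subst_inst: "subst \<sigma> (inst \<phi> t) = subst (case_nat (subst_tm \<sigma> t) \<sigma>) \<phi>"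
proof -
  have "(\<lambda>n. subst_tm \<sigma> (case_nat t Var n)) = case_nat (subst_tm \<sigma> t) \<sigma>"
    by (auto simp: fun_eq_iff split: nat.split)
  then show ?thesis by (simp add: inst_def subst_comp)
qed

lemma inst_neg: "inst (neg \<phi>) t = neg (inst \<phi> t)"
  by (simp add: inst_def)

text \<open>A shifted formula does not mention index 0. This is the eigenvariable condition at work:
  side formulas do not see the choice of \<open>t\<close>.\<close>

lemma subst_shift: "subst (case_nat t \<sigma>) (shift \<phi>) = subst \<sigma> \<phi>"
  by (simp add: shift_def subst_comp)

lemma sat_inst: "sat A e (inst \<phi> t) = sat A (case_nat (eval e t) e) \<phi>"
proof -
  have "(\<lambda>n. eval e (case_nat t Var n)) = case_nat (eval e t) e"
    by (auto simp: fun_eq_iff split: nat.split)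
  then show ?thesis by (simp add: inst_def sat_subst)
qed

lemma val_subst_tm_cong:
  "(\<And>n. val (\<sigma> n) = val (\<tau> n)) \<Longrightarrow> val (subst_tm \<sigma> t) = val (subst_tm \<tau> t)"
  by (simp add: val_def eval_subst_tm)

primrec numeral_tm :: "nat \<Rightarrow> tm" where
  "numeral_tm 0 = Zero"
| "numeral_tm (Suc n) = Succ (numeral_tm n)"

lemma closed_numeral_tm [simp]: "closed_tm (numeral_tm n)"
  by (induction n) auto

lemma eval_numeral_tm [simp]: "eval e (numeral_tm n) = n"
  by (induction n) auto

lemma val_numeral_tm [simp]: "val (numeral_tm n) = n"
  by (simp add: val_def)


section \<open>Rules of the infinitary calculus\<close>

lemma infd_sequent: "infd R \<alpha> d \<Gamma> \<Longrightarrow> sequent \<Gamma>"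
  by (erule infd.cases) auto

lemma sequent_insert [simp]: "sequent (insert \<phi> \<Gamma>) \<longleftrightarrow> sentence \<phi> \<and> sequent \<Gamma>"
  by (auto simp: sequent_def)

lemma sequent_empty [simp]: "sequent {}"
  by (simp add: sequent_def)

text \<open>Reapplying the last rule suffices: premises may have any smaller height, any cut rank up
  to the bound and any subset of the allowed formulas, so the old premises also serve the enlarged
  conclusion.\<close>

lemma infd_weaken:
  assumes "infd R \<alpha> d \<Gamma>" "\<alpha> \<le> \<beta>" "d \<le> e" "\<Gamma> \<subseteq> \<Delta>" "sequent \<Delta>"
  shows "infd R \<beta> e \<Delta>"
proof -
  have prem: "\<exists>\<gamma><\<beta>. \<exists>c\<le>e. \<exists>\<Theta>. \<Theta> \<subseteq> insert \<psi> \<Delta> \<and> infd R \<gamma> c \<Theta>"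
    if "\<exists>\<gamma><\<alpha>. \<exists>c\<le>d. \<exists>\<Theta>. \<Theta> \<subseteq> insert \<psi> \<Gamma> \<and> infd R \<gamma> c \<Theta>" for \<psi>
  proof -
    from that obtain \<gamma> c \<Theta> where "\<gamma> < \<alpha>" "c \<le> d" "\<Theta> \<subseteq> insert \<psi> \<Gamma>" "infd R \<gamma> c \<Theta>" by blast
    moreover from this assms(2-4) have "\<gamma> < \<beta>" "c \<le> e" "\<Theta> \<subseteq> insert \<psi> \<Delta>" by auto
    ultimately show ?thesis by blast
  qed
  from assms(1) show ?thesis
  proof cases
    case (true_lit \<phi>) then show ?thesis using assms by (blast intro: infd.true_lit)
  next
    case (X_lit s t) then show ?thesis using assms by (blast intro: infd.X_lit)
  next
    case (conj \<phi> \<psi>)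
    show ?thesis
    proof (rule infd.conj[OF assms(5)])
      show "And \<phi> \<psi> \<in> \<Delta>" using conj assms by blast
    qed (intro ballI prem, erule bspec[OF conj(3)])
  next
    case (disj \<phi> \<psi>)
    show ?thesis
    proof (rule infd.disj[OF assms(5)])
      show "Or \<phi> \<psi> \<in> \<Delta>" using disj assms by blast
    qed (rule bexE[OF disj(3)], erule bexI[rotated], erule prem)
  next
    case (all \<phi>)
    show ?thesis
    proof (rule infd.all[OF assms(5)])
      show "All \<phi> \<in> \<Delta>" using all assms by blast
    qed (intro allI impI prem, erule all(3)[THEN spec, THEN mp])
  next
    case (ex \<phi>)
    from ex(3) obtain t where t: "closed_tm t"
      "\<exists>\<gamma><\<alpha>. \<exists>c\<le>d. \<exists>\<Theta>. \<Theta> \<subseteq> insert (inst \<phi> t) \<Gamma> \<and> infd R \<gamma> c \<Theta>" by blast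
    show ?thesis
    proof (rule infd.ex[OF assms(5)])
      show "Ex \<phi> \<in> \<Delta>" using ex assms by blast
    qed (rule exI, rule conjI[OF t(1) prem[OF t(2)]])
  next
    case (prog t)
    show ?thesis
    proof (rule infd.prog[OF assms(5)])
      show "Pos (InX t) \<in> \<Delta>" using prog assms by blast
    qed (intro allI impI prem, erule prog(3)[THEN spec, THEN mp])
  next
    case (cut \<phi>)
    show ?thesis
    proof (rule infd.cut[OF assms(5)])
      show "sentence \<phi>" "rk \<phi> < e" using cut assms by auto
    qed (intro ballI prem, erule bspec[OF cut(4)])
  qed
qed

section \<open>Derived rules whose premises carry the full side context\<close>

lemma infd_conjI:
  assumes "And \<phi> \<psi> \<in> \<Gamma>" "infd R \<beta> d (insert \<phi> \<Gamma>)" "infd R \<gamma> d (insert \<psi> \<Gamma>)" "\<beta> < \<alpha>" "\<gamma> < \<alpha>"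
  shows "infd R \<alpha> d \<Gamma>"
proof (rule infd.conj)
  show "sequent \<Gamma>" using infd_sequent[OF assms(2)] by simp
qed (use assms in blast)+

lemma infd_disjI1:
  assumes "Or \<phi> \<psi> \<in> \<Gamma>" "infd R \<beta> d (insert \<phi> \<Gamma>)" "\<beta> < \<alpha>"
  shows "infd R \<alpha> d \<Gamma>"
proof (rule infd.disj)
  show "sequent \<Gamma>" using infd_sequent[OF assms(2)] by simp
qed (use assms in blast)+

lemma infd_disjI2:
  assumes "Or \<phi> \<psi> \<in> \<Gamma>" "infd R \<beta> d (insert \<psi> \<Gamma>)" "\<beta> < \<alpha>"
  shows "infd R \<alpha> d \<Gamma>"
proof (rule infd.disj)
  show "sequent \<Gamma>" using infd_sequent[OF assms(2)] by simp
qed (use assms in blast)+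

text \<open>\<open>infd.disj\<close> adds one disjunct, the finitary rule both. Two applications to
  the same formula bridge this; \<open>\<gamma>\<close> is the height between them.\<close>

lemma infd_disjI:
  assumes "Or \<phi> \<psi> \<in> \<Gamma>" "infd R \<beta> d (insert \<phi> (insert \<psi> \<Gamma>))" "\<beta> < \<gamma>" "\<gamma> < \<alpha>"
  shows "infd R \<alpha> d \<Gamma>"
proof (rule infd_disjI2[OF assms(1)])
  show "infd R \<gamma> d (insert \<psi> \<Gamma>)"
    by (rule infd_disjI1[OF insertI2[OF assms(1)] assms(2,3)])
qed fact

lemma infd_allI:
  assumes "All \<phi> \<in> \<Gamma>" "\<And>t. closed_tm t \<Longrightarrow> infd R (\<beta> t) d (insert (inst \<phi> t) \<Gamma>)"
    "\<And>t. closed_tm t \<Longrightarrow> \<beta> t < \<alpha>"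
  shows "infd R \<alpha> d \<Gamma>"
proof (rule infd.all)
  show "sequent \<Gamma>" using infd_sequent[OF assms(2)[of Zero]] by simp
qed (use assms in blast)+

lemma infd_exI:
  assumes "Ex \<phi> \<in> \<Gamma>" "closed_tm t" "infd R \<beta> d (insert (inst \<phi> t) \<Gamma>)" "\<beta> < \<alpha>"
  shows "infd R \<alpha> d \<Gamma>"
proof (rule infd.ex)
  show "sequent \<Gamma>" using infd_sequent[OF assms(3)] by simp
qed (use assms in blast)+

lemma infd_cutI:
  assumes "infd R \<beta> d (insert \<phi> \<Gamma>)" "infd R \<gamma> d (insert (neg \<phi>) \<Gamma>)" "rk \<phi> < d" "\<beta> < \<alpha>" "\<gamma> < \<alpha>"
  shows "infd R \<alpha> d \<Gamma>"
proof (rule infd.cut)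
  show "sequent \<Gamma>" "sentence \<phi>" using infd_sequent[OF assms(1)] by simp_all
qed (use assms in blast)+

text \<open>That \<open>\<Gamma>\<close> is a sequent cannot be read off a premise here: there is
  none if \<open>val t\<close> is minimal.\<close>

lemma infd_progI:
  assumes "sequent \<Gamma>" "Pos (InX t) \<in> \<Gamma>"
    "\<And>s. closed_tm s \<Longrightarrow> R (val s) (val t) \<Longrightarrow> infd R \<beta> d (insert (Pos (InX s)) \<Gamma>)" "\<beta> < \<alpha>"
  shows "infd R \<alpha> d \<Gamma>"
  by (rule infd.prog[OF assms(1,2)]) (use assms(3,4) in blast)

text \<open>An arithmetical atom has the same truth value under both substitutions, so one of the
  two literals is true; for \<open>X\<close> the rule \<open>X_lit\<close> applies.\<close>

lemma infd_literals:
  assumes "sequent \<Gamma>" "Pos (subst_prime \<sigma> p) \<in> \<Gamma>" "Neg (subst_prime \<tau> p) \<in> \<Gamma>"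
    and val: "\<And>n. val (\<sigma> n) = val (\<tau> n)"
  shows "infd R \<alpha> d \<Gamma>"
proof (cases p)
  case (InX t)
  then show ?thesis using assms(1-3) val_subst_tm_cong[OF val]
    by (auto intro: infd.X_lit)
next
  case (Eq s t)
  have "true_PA_literal (Pos (subst_prime \<sigma> p)) \<or> true_PA_literal (Neg (subst_prime \<tau> p))"
    using assms(1-3) val_subst_tm_cong[OF val, where t = s] val_subst_tm_cong[OF val, where t = t]
    by (auto simp: Eq true_PA_literal_def sequent_def val_def)
  then show ?thesis using assms(1-3) by (blast intro: infd.true_lit)
next
  case (Le s t)
  have "true_PA_literal (Pos (subst_prime \<sigma> p)) \<or> true_PA_literal (Neg (subst_prime \<tau> p))"
    using assms(1-3) val_subst_tm_cong[OF val, where t = s] val_subst_tm_cong[OF val, where t = t]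
    by (auto simp: Le true_PA_literal_def sequent_def val_def)
  then show ?thesis using assms(1-3) by (blast intro: infd.true_lit)
qed


section \<open>Embedding \<open>PA[X]\<close> into the infinitary calculus\<close>

locale heights =
  fixes succ :: "'e::wellorder \<Rightarrow> 'e" and zero omega :: 'e
  assumes succ_gt: "\<alpha> < succ \<alpha>"
    and zero_less_omega: "zero < omega"
    and omega_limit: "\<alpha> < omega \<Longrightarrow> succ \<alpha> < omega"
begin

text \<open>\<open>fin n\<close> plays the role of the ordinal n, and \<open>lim n\<close> that of
  omega + n.\<close>

definition fin :: "nat \<Rightarrow> 'e" where
  "fin n = (succ ^^ n) zero"

definition lim :: "nat \<Rightarrow> 'e" where
  "lim n = (succ ^^ n) omega"

lemma strict_mono_fin: "strict_mono fin"
  by (rule strict_mono_Suc_iff[THEN iffD2]) (simp add: fin_def succ_gt)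

lemma strict_mono_lim: "strict_mono lim"
  by (rule strict_mono_Suc_iff[THEN iffD2]) (simp add: lim_def succ_gt)

lemma fin_less [simp]: "fin m < fin n \<longleftrightarrow> m < n"
  by (rule strict_mono_less[OF strict_mono_fin])

lemma lim_less [simp]: "lim m < lim n \<longleftrightarrow> m < n"
  by (rule strict_mono_less[OF strict_mono_lim])

lemma lim_le [simp]: "lim m \<le> lim n \<longleftrightarrow> m \<le> n"
  by (rule strict_mono_less_eq[OF strict_mono_lim])

lemma fin_less_lim [simp]: "fin m < lim n"
proof -
  have "fin m < omega"
    by (induction m) (simp_all add: fin_def zero_less_omega omega_limit)
  also have "omega \<le> lim n" using lim_le[of 0 n] by (simp add: lim_def)
  finally show ?thesis .
qed

text \<open>A true compound sentence has a rule whose premises add true sentences of smaller rank.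
  Induction is on the rank because the quantifier rules lead to instances, not subformulas.\<close>

lemma infd_true:
  assumes "PA_fm \<phi>" "sat {} (\<lambda>_. 0) \<phi>" "\<phi> \<in> \<Gamma>" "sequent \<Gamma>"
  shows "infd R (fin (rk \<phi>)) d \<Gamma>"
  using assms
proof (induction "rk \<phi>" arbitrary: \<phi> \<Gamma> rule: less_induct)
  case less
  have sent: "sentence \<phi>" using less.prems by (auto simp: sequent_def)
  have IH: "infd R (fin (rk \<psi>)) d (insert \<psi> \<Gamma>)"
    if "rk \<psi> < rk \<phi>" "PA_fm \<psi>" "sat {} (\<lambda>_. 0) \<psi>" "sentence \<psi>" for \<psi>
    using less.hyps[OF that(1,2,3), of "insert \<psi> \<Gamma>"] that less.prems by simp
  show ?case
  proof (cases \<phi>)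
    case (Pos p)
    then show ?thesis using less.prems sent by (auto intro!: infd.true_lit simp: true_PA_literal_def)
  next
    case (Neg p)
    then show ?thesis using less.prems sent by (auto intro!: infd.true_lit simp: true_PA_literal_def)
  next
    case (And \<psi> \<chi>)
    then show ?thesis using less.prems sent
      by (intro infd_conjI[OF _ IH IH]) (auto simp: sentence_def)
  next
    case (Or \<psi> \<chi>)
    then consider "sat {} (\<lambda>_. 0) \<psi>" | "sat {} (\<lambda>_. 0) \<chi>" using less.prems by auto
    then show ?thesis
    proof cases
      case 1
      with Or show ?thesis using less.prems sent
        by (intro infd_disjI1[OF _ IH]) (auto simp: sentence_def)
    next
      case 2
      with Or show ?thesis using less.prems sent
        by (intro infd_disjI2[OF _ IH]) (auto simp: sentence_def)
    qed
  next
    case (All \<psi>)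
    show ?thesis
    proof (rule infd_allI)
      fix t assume "closed_tm t"
      with All less.prems sent show "infd R (fin (rk (inst \<psi> t))) d (insert (inst \<psi> t) \<Gamma>)"
        by (intro IH) (auto simp: sat_inst sentence_inst, simp add: inst_def)
    qed (use All less.prems in simp_all)
  next
    case (Ex \<psi>)
    then obtain n where n: "sat {} (case_nat n (\<lambda>_. 0)) \<psi>" using less.prems by auto
    \<comment> \<open>The rule wants a closed term, so the witness in the model is named by its
      numeral.\<close>
    have "sentence (inst \<psi> (numeral_tm n))"
      using sent Ex by (intro sentence_inst) (auto simp: sentence_def)
    then have "infd R (fin (rk (inst \<psi> (numeral_tm n)))) d (insert (inst \<psi> (numeral_tm n)) \<Gamma>)"
      using Ex less.prems n by (intro IH) (auto simp: sat_inst, simp add: inst_def)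
    then show ?thesis by (rule infd_exI[rotated 2]) (use Ex less.prems in auto)
  qed
qed

text \<open>Structural induction works because instances only extend \<open>\<sigma>\<close> and
  \<open>\<tau>\<close>. Each connective is opened on both sides, whence the factor 2. Two
  substitutions of equal value are allowed because the induction axiom compares distinct terms of
  equal value.\<close>

lemma infd_excluded_middle:
  assumes "subst \<sigma> \<phi> \<in> \<Gamma>" "neg (subst \<tau> \<phi>) \<in> \<Gamma>" "sequent \<Gamma>"
    "closed_sub \<sigma>" "closed_sub \<tau>" "\<And>n. val (\<sigma> n) = val (\<tau> n)"
  shows "infd R (fin (2 * rk \<phi>)) d \<Gamma>"
  using assms
proof (induction \<phi> arbitrary: \<sigma> \<tau> \<Gamma>)
  case (Pos p)
  then show ?case by (intro infd_literals[of \<Gamma> \<sigma> p \<tau>]) auto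
next
  case (Neg p)
  then show ?case by (intro infd_literals[of \<Gamma> \<tau> p \<sigma>]) auto
next
  case (And \<phi> \<psi>)
  \<comment> \<open>Read from the root, the conjunction is opened first, then its negation in each
    branch; \<open>Suc ?r\<close> is the height between the two steps.\<close>
  let ?r = "2 * max (rk \<phi>) (rk \<psi>)"
  have "infd R (fin (Suc ?r)) d (insert (subst \<sigma> \<phi>) \<Gamma>)"
  proof (rule infd_disjI1)
    show "infd R (fin (2 * rk \<phi>)) d (insert (neg (subst \<tau> \<phi>)) (insert (subst \<sigma> \<phi>) \<Gamma>))"
      by (rule And.IH(1)[of \<sigma> _ \<tau>]) (use And.prems in auto)
  qed (use And.prems in auto)
  moreover have "infd R (fin (Suc ?r)) d (insert (subst \<sigma> \<psi>) \<Gamma>)"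
  proof (rule infd_disjI2)
    show "infd R (fin (2 * rk \<psi>)) d (insert (neg (subst \<tau> \<psi>)) (insert (subst \<sigma> \<psi>) \<Gamma>))"
      by (rule And.IH(2)[of \<sigma> _ \<tau>]) (use And.prems in auto)
  qed (use And.prems in auto)
  ultimately show ?case by (rule infd_conjI[rotated]) (use And.prems in auto)
next
  case (Or \<phi> \<psi>)
  let ?r = "2 * max (rk \<phi>) (rk \<psi>)"
  have "infd R (fin (Suc ?r)) d (insert (neg (subst \<tau> \<phi>)) \<Gamma>)"
  proof (rule infd_disjI1)
    show "infd R (fin (2 * rk \<phi>)) d (insert (subst \<sigma> \<phi>) (insert (neg (subst \<tau> \<phi>)) \<Gamma>))"
      by (rule Or.IH(1)[of \<sigma> _ \<tau>]) (use Or.prems in auto)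
  qed (use Or.prems in auto)
  moreover have "infd R (fin (Suc ?r)) d (insert (neg (subst \<tau> \<psi>)) \<Gamma>)"
  proof (rule infd_disjI2)
    show "infd R (fin (2 * rk \<psi>)) d (insert (subst \<sigma> \<psi>) (insert (neg (subst \<tau> \<psi>)) \<Gamma>))"
      by (rule Or.IH(2)[of \<sigma> _ \<tau>]) (use Or.prems in auto)
  qed (use Or.prems in auto)
  ultimately show ?case by (rule infd_conjI[rotated]) (use Or.prems in auto)
next
  case (All \<phi>)
  show ?case
  proof (rule infd_allI)
    show "All (subst (up \<sigma>) \<phi>) \<in> \<Gamma>" using All.prems by simp
    fix t assume t: "closed_tm t"
    show "infd R (fin (Suc (2 * rk \<phi>))) d (insert (inst (subst (up \<sigma>) \<phi>) t) \<Gamma>)"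
    proof (rule infd_exI[OF _ t])
      show "infd R (fin (2 * rk \<phi>)) d
        (insert (inst (neg (subst (up \<tau>) \<phi>)) t) (insert (inst (subst (up \<sigma>) \<phi>) t) \<Gamma>))"
        by (rule All.IH[of "case_nat t \<sigma>" _ "case_nat t \<tau>"])
          (use All.prems t in \<open>auto simp: inst_neg inst_subst_up split: nat.split\<close>)
    qed (use All.prems in auto)
  qed simp
next
  case (Ex \<phi>)
  show ?case
  proof (rule infd_allI)
    show "All (neg (subst (up \<tau>) \<phi>)) \<in> \<Gamma>" using Ex.prems by simp
    fix t assume t: "closed_tm t"
    show "infd R (fin (Suc (2 * rk \<phi>))) d (insert (inst (neg (subst (up \<tau>) \<phi>)) t) \<Gamma>)"
    proof (rule infd_exI[OF _ t])
      show "infd R (fin (2 * rk \<phi>)) d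
        (insert (inst (subst (up \<sigma>) \<phi>) t) (insert (inst (neg (subst (up \<tau>) \<phi>)) t) \<Gamma>))"
        by (rule Ex.IH[of "case_nat t \<sigma>" _ "case_nat t \<tau>"])
          (use Ex.prems t in \<open>auto simp: inst_neg inst_subst_up split: nat.split\<close>)
    qed (use Ex.prems in auto)
  qed simp
qed

text \<open>For each closed \<open>t\<close>, a derivation of finite height climbs from
  \<open>Zero\<close> to the value of \<open>t\<close>. These heights grow with \<open>t\<close> but
  stay below \<open>omega\<close>, so the universal formula is introduced at \<open>lim 0\<close>.
  Opening the two disjunctions of the axiom costs two steps each, which gives
  \<open>lim 4\<close>.\<close>

lemma infd_induction_axiom:
  assumes "closed_sub \<sigma>" "sequent \<Gamma>" "subst \<sigma> (induction_axiom \<phi>) \<in> \<Gamma>"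
  shows "infd R (lim 4) d \<Gamma>"
proof -
  let ?F = "\<lambda>t. subst (case_nat t \<sigma>) \<phi>"
  \<comment> \<open>\<open>Ex ?step\<close> negates the induction step: \<open>\<phi>\<close> holds
    somewhere but fails at the successor.\<close>
  let ?step = "And (subst (up \<sigma>) \<phi>) (neg (subst (up \<sigma>) (subst (Var(0 := Succ v0)) \<phi>)))"
  let ?base = "neg (subst \<sigma> (inst \<phi> Zero))"
  have base: "?base = neg (?F Zero)"
    by (simp add: subst_inst)
  have step: "inst ?step t = And (?F t) (neg (?F (Succ t)))" for t
  proof -
    have "(\<lambda>n. subst_tm (case_nat t \<sigma>) ((Var(0 := Succ v0)) n)) = case_nat (Succ t) \<sigma>"
      by (auto simp: fun_eq_iff split: nat.split)
    then show ?thesis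
      using inst_subst_up[of \<sigma> "subst (Var(0 := Succ v0)) \<phi>" t] inst_subst_up[of \<sigma> \<phi> t]
        subst_comp[of "case_nat t \<sigma>" "Var(0 := Succ v0)" \<phi>]
      by (simp add: inst_def del: fun_upd_apply)
  qed
  have sent: "sentence (?F t)" if "closed_tm t" for t
    using that assms(1) by simp
  have taut: "infd R (fin (2 * rk \<phi>)) d \<Delta>"
    if "?F s \<in> \<Delta>" "neg (?F t) \<in> \<Delta>" "val s = val t" "closed_tm s" "closed_tm t" "sequent \<Delta>" for s t \<Delta>
    by (rule infd_excluded_middle[OF that(1,2)]) (use that assms(1) in \<open>auto split: nat.split\<close>)
  \<comment> \<open>Each unit of \<open>val t\<close> costs a conjunction and an existential step.
    \<open>\<Delta>\<close> is arbitrary because it grows at every unit.\<close>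
  have ind: "infd R (fin (2 * rk \<phi> + 2 * val t)) d \<Delta>"
    if "closed_tm t" "?F t \<in> \<Delta>" "?base \<in> \<Delta>" "Ex ?step \<in> \<Delta>" "sequent \<Delta>" for t \<Delta>
    using that
  proof (induction "val t" arbitrary: t \<Delta>)
    case 0
    \<comment> \<open>\<open>t\<close> has value 0 but need not be \<open>Zero\<close>
      itself.\<close>
    then have "infd R (fin (2 * rk \<phi>)) d \<Delta>"
      by (intro taut[of t _ Zero]) (simp_all add: base val_def)
    then show ?case using 0 by simp
  next
    case (Suc n)
    \<comment> \<open>\<open>t\<close> need not have the form \<open>Succ u\<close>, so the step is
      instantiated at a numeral, and its successor is matched with \<open>t\<close> by
      value.\<close>
    let ?n = "numeral_tm n"
    let ?\<Delta> = "insert (And (?F ?n) (neg (?F (Succ ?n)))) \<Delta>"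
    have sq: "sequent ?\<Delta>" "sequent (insert (?F ?n) ?\<Delta>)" "sequent (insert (neg (?F (Succ ?n))) ?\<Delta>)"
      using Suc.prems sent[of ?n] sent[of "Succ ?n"] by (simp_all add: sentence_def)
    have "infd R (fin (2 * rk \<phi> + 2 * val ?n)) d (insert (?F ?n) ?\<Delta>)"
      using Suc.prems sq by (intro Suc.hyps(1)) auto
    moreover have "infd R (fin (2 * rk \<phi>)) d (insert (neg (?F (Succ ?n))) ?\<Delta>)"
      using Suc.prems Suc.hyps(2) sq by (intro taut[of t _ "Succ ?n"]) (auto simp: val_def)
    ultimately have "infd R (fin (2 * rk \<phi> + 2 * n + 1)) d ?\<Delta>"
      by (rule infd_conjI[rotated]) auto
    then have "infd R (fin (2 * rk \<phi> + 2 * n + 1)) d (insert (inst ?step ?n) \<Delta>)"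
      by (simp add: step)
    then show ?case
      by (rule infd_exI[rotated 2]) (use Suc.prems Suc.hyps(2)[symmetric] in auto)
  qed
  have ax: "subst \<sigma> (induction_axiom \<phi>) = Or (Or ?base (Ex ?step)) (All (subst (up \<sigma>) \<phi>))"
    by (simp add: induction_axiom_def Imp_def)
  let ?\<Gamma>1 = "insert (Or ?base (Ex ?step)) (insert (All (subst (up \<sigma>) \<phi>)) \<Gamma>)"
  let ?\<Gamma>2 = "insert ?base (insert (Ex ?step) ?\<Gamma>1)"
  have sq: "sequent ?\<Gamma>2"
    using assms(2,3) by (auto simp: ax sequent_def sentence_def)
  have "infd R (lim 0) d ?\<Gamma>2"
  proof (rule infd_allI)
    fix t assume t: "closed_tm t"
    show "infd R (fin (2 * rk \<phi> + 2 * val t)) d (insert (inst (subst (up \<sigma>) \<phi>) t) ?\<Gamma>2)"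
      by (rule ind[OF t]) (use sq t assms(1) in \<open>auto simp: inst_subst_up\<close>)
  qed simp_all
  then have "infd R (lim 2) d ?\<Gamma>1"
    by (rule infd_disjI[rotated, where \<gamma> = "lim 1"]) auto
  then show ?thesis
    by (rule infd_disjI[rotated, where \<gamma> = "lim 3"]) (use assms(3) ax in auto)
qed

lemma infd_true_axiom:
  assumes "closed_sub \<sigma>" "sequent \<Gamma>" "subst \<sigma> \<phi> \<in> \<Gamma>" "PA_fm \<phi>" "\<And>e. sat {} e \<phi>"
  shows "infd R (lim k) d \<Gamma>"
proof -
  have "infd R (fin (rk (subst \<sigma> \<phi>))) d \<Gamma>"
    by (rule infd_true) (use assms in \<open>auto simp: sat_subst\<close>)
  then show ?thesis
    by (rule infd_weaken) (auto intro: less_imp_le assms(2))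
qed

text \<open>\<open>X\<close> has no fixed interpretation, so the values decide: equal ones close the
  sequent by \<open>X_lit\<close>, different ones make the negated equation a true literal.\<close>

lemma infd_X_congruence:
  assumes "closed_sub \<sigma>" "sequent \<Gamma>"
    "subst \<sigma> (Imp (Pos (Eq v0 v1)) (Imp (Pos (InX v0)) (Pos (InX v1)))) \<in> \<Gamma>"
  shows "infd R (lim 4) d \<Gamma>"
proof -
  let ?eq = "Neg (Eq (\<sigma> 0) (\<sigma> 1))" and ?x = "Neg (InX (\<sigma> 0))" and ?y = "Pos (InX (\<sigma> 1))"
  have ax: "subst \<sigma> (Imp (Pos (Eq v0 v1)) (Imp (Pos (InX v0)) (Pos (InX v1)))) = Or ?eq (Or ?x ?y)"
    by (simp add: Imp_def)
  let ?\<Gamma>1 = "insert ?eq (insert (Or ?x ?y) \<Gamma>)"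
  let ?\<Gamma>2 = "insert ?x (insert ?y ?\<Gamma>1)"
  have sq: "sequent ?\<Gamma>2"
    using assms(2,3) unfolding ax by (auto simp: sequent_def sentence_def)
  have "infd R (lim 0) d ?\<Gamma>2"
  proof (cases "val (\<sigma> 0) = val (\<sigma> 1)")
    case True
    then show ?thesis by (intro infd.X_lit[OF sq, of "\<sigma> 1" "\<sigma> 0"]) auto
  next
    case False
    moreover have "sentence ?eq" using sq by simp
    ultimately show ?thesis
      by (intro infd.true_lit[OF sq, of ?eq]) (auto simp: true_PA_literal_def val_def)
  qed
  then have "infd R (lim 2) d ?\<Gamma>1"
    by (rule infd_disjI[rotated, where \<gamma> = "lim 1"]) auto
  then show ?thesis
    by (rule infd_disjI[rotated, where \<gamma> = "lim 3"]) (use assms(3) ax in auto)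
qed

lemma infd_PAX:
  assumes "\<phi> \<in> PAX" "closed_sub \<sigma>" "sequent \<Gamma>" "subst \<sigma> \<phi> \<in> \<Gamma>"
  shows "infd R (lim 4) d \<Gamma>"
proof -
  \<comment> \<open>Apart from induction, \<open>X\<close> occurs only in its congruence axiom; the
    other axioms are arithmetical and true.\<close>
  consider "\<phi> \<in> range induction_axiom"
    | "\<phi> = Imp (Pos (Eq v0 v1)) (Imp (Pos (InX v0)) (Pos (InX v1)))"
    | "PA_fm \<phi>" "\<forall>e. sat {} e \<phi>"
  proof (cases "\<phi> \<in> robinson_axioms")
    case True
    \<comment> \<open>A nonzero number has a predecessor, and x \<le> y is witnessed by y -
      x.\<close>
    then have "PA_fm \<phi> \<and> (\<forall>e. sat {} e \<phi>)"
      unfolding robinson_axioms_def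
      by (auto simp: Imp_def Iff_def numeral_2_eq_2 gr0_conv_Suc[symmetric])
        (metis le_add_diff_inverse2)
    then show ?thesis using that by blast
  next
    case False
    then show ?thesis
    proof (cases "\<phi> \<in> equality_axioms")
      case True
      then have "\<phi> = Imp (Pos (Eq v0 v1)) (Imp (Pos (InX v0)) (Pos (InX v1)))
          \<or> (PA_fm \<phi> \<and> (\<forall>e. sat {} e \<phi>))"
        unfolding equality_axioms_def by (elim insertE) (auto simp: Imp_def)
      then show ?thesis using that by blast
    next
      case not_eq: False
      then show ?thesis using that assms(1) False by (auto simp: PAX_def)
    qed
  qed
  then show ?thesis
  proof cases
    case 1 then show ?thesis using assms infd_induction_axiom by blast
  next
    case 2 then show ?thesis using assms infd_X_congruence by blast
  next
    case 3 then show ?thesis using assms infd_true_axiom by blast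
  qed
qed

text \<open>The bounds \<open>k\<close> and \<open>d\<close> precede \<open>\<sigma>\<close>
  because, in the case \<open>all\<close>, the infinitely many premises come from one hypothesis
  under different extensions of \<open>\<sigma>\<close> and need a common height and cut
  rank.\<close>

theorem fol_derivable_imp_infd:
  assumes "fol_derivable PAX \<Gamma>"
  shows "\<exists>k d. \<forall>\<sigma>. closed_sub \<sigma> \<longrightarrow> infd R (lim k) d (subst \<sigma> ` \<Gamma>)"
  using assms
proof induction
  case (lit \<Gamma> p)
  have "infd R (lim 0) 0 (subst \<sigma> ` \<Gamma>)" if "closed_sub \<sigma>" for \<sigma>
    by (rule infd_literals[of _ \<sigma> p \<sigma>])
      (use that lit in \<open>auto simp: sequent_def intro: rev_image_eqI\<close>)
  then show ?case by blast
next
  case (ax \<Gamma> \<phi>)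
  have "infd R (lim 4) 0 (subst \<sigma> ` \<Gamma>)" if "closed_sub \<sigma>" for \<sigma>
    by (rule infd_PAX[OF ax(2) that]) (use that ax in \<open>auto simp: sequent_def\<close>)
  then show ?case by blast
next
  case (conj \<phi> \<psi> \<Gamma>)
  from conj.IH obtain k d k' d' where
    IH: "\<And>\<sigma>. closed_sub \<sigma> \<Longrightarrow> infd R (lim k) d (subst \<sigma> ` insert \<phi> \<Gamma>)"
        "\<And>\<sigma>. closed_sub \<sigma> \<Longrightarrow> infd R (lim k') d' (subst \<sigma> ` insert \<psi> \<Gamma>)" by blast
  have "infd R (lim (Suc (max k k'))) (max d d') (subst \<sigma> ` \<Gamma>)" if s: "closed_sub \<sigma>" for \<sigma>
  proof (rule infd_conjI)
    show "And (subst \<sigma> \<phi>) (subst \<sigma> \<psi>) \<in> subst \<sigma> ` \<Gamma>" using conj.hyps(1) by force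
    show "infd R (lim k) (max d d') (insert (subst \<sigma> \<phi>) (subst \<sigma> ` \<Gamma>))"
      using infd_sequent[OF IH(1)[OF s]] by (intro infd_weaken[OF IH(1)[OF s]]) auto
    show "infd R (lim k') (max d d') (insert (subst \<sigma> \<psi>) (subst \<sigma> ` \<Gamma>))"
      using infd_sequent[OF IH(2)[OF s]] by (intro infd_weaken[OF IH(2)[OF s]]) auto
  qed auto
  then show ?case by blast
next
  case (disj \<phi> \<psi> \<Gamma>)
  from disj.IH obtain k d where
    IH: "\<And>\<sigma>. closed_sub \<sigma> \<Longrightarrow> infd R (lim k) d (subst \<sigma> ` insert \<phi> (insert \<psi> \<Gamma>))" by blast
  have "infd R (lim (k + 2)) d (subst \<sigma> ` \<Gamma>)" if s: "closed_sub \<sigma>" for \<sigma>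
  proof (rule infd_disjI[where \<beta> = "lim k" and \<gamma> = "lim (k + 1)"])
    show "Or (subst \<sigma> \<phi>) (subst \<sigma> \<psi>) \<in> subst \<sigma> ` \<Gamma>" using disj.hyps(1) by force
    show "infd R (lim k) d (insert (subst \<sigma> \<phi>) (insert (subst \<sigma> \<psi>) (subst \<sigma> ` \<Gamma>)))"
      using IH[OF s] by simp
  qed auto
  then show ?case by blast
next
  case (all \<phi> \<Gamma>)
  from all.IH obtain k d where
    IH: "\<And>\<sigma>. closed_sub \<sigma> \<Longrightarrow> infd R (lim k) d (subst \<sigma> ` insert \<phi> (shift ` \<Gamma>))" by blast
  have "infd R (lim (Suc k)) d (subst \<sigma> ` \<Gamma>)" if s: "closed_sub \<sigma>" for \<sigma>
  proof (rule infd_allI)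
    show "All (subst (up \<sigma>) \<phi>) \<in> subst \<sigma> ` \<Gamma>" using all.hyps(1) by force
    fix t assume t: "closed_tm t"
    \<comment> \<open>The eigenvariable receives \<open>t\<close>; the shifted side formulas revert
      to their instances under \<open>\<sigma>\<close>.\<close>
    show "infd R (lim k) d (insert (inst (subst (up \<sigma>) \<phi>) t) (subst \<sigma> ` \<Gamma>))"
      using IH[of "case_nat t \<sigma>"] s t by (simp add: image_image subst_shift inst_subst_up)
  qed simp
  then show ?case by blast
next
  case (ex \<phi> \<Gamma> t)
  from ex.IH obtain k d where
    IH: "\<And>\<sigma>. closed_sub \<sigma> \<Longrightarrow> infd R (lim k) d (subst \<sigma> ` insert (inst \<phi> t) \<Gamma>)" by blast
  have "infd R (lim (Suc k)) d (subst \<sigma> ` \<Gamma>)" if s: "closed_sub \<sigma>" for \<sigma>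
  proof (rule infd_exI)
    show "Ex (subst (up \<sigma>) \<phi>) \<in> subst \<sigma> ` \<Gamma>" using ex.hyps(1) by force
    \<comment> \<open>The witness may have free variables, so its closed instance is used.\<close>
    show "infd R (lim k) d (insert (inst (subst (up \<sigma>) \<phi>) (subst_tm \<sigma> t)) (subst \<sigma> ` \<Gamma>))"
      using IH[OF s] by (simp add: subst_inst inst_subst_up)
  qed (use s in auto)
  then show ?case by blast
next
  case (cut \<phi> \<Gamma>)
  from cut.IH obtain k d k' d' where
    IH: "\<And>\<sigma>. closed_sub \<sigma> \<Longrightarrow> infd R (lim k) d (subst \<sigma> ` insert \<phi> \<Gamma>)"
        "\<And>\<sigma>. closed_sub \<sigma> \<Longrightarrow> infd R (lim k') d' (subst \<sigma> ` insert (neg \<phi>) \<Gamma>)" by blast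
  \<comment> \<open>Substitution preserves rank, so one bound exceeds the ranks of all instances of
    the cut formula.\<close>
  let ?d = "max (Suc (rk \<phi>)) (max d d')"
  have "infd R (lim (Suc (max k k'))) ?d (subst \<sigma> ` \<Gamma>)" if s: "closed_sub \<sigma>" for \<sigma>
  proof (rule infd_cutI)
    show "infd R (lim k) ?d (insert (subst \<sigma> \<phi>) (subst \<sigma> ` \<Gamma>))"
      using infd_sequent[OF IH(1)[OF s]] by (intro infd_weaken[OF IH(1)[OF s]]) auto
    show "infd R (lim k') ?d (insert (neg (subst \<sigma> \<phi>)) (subst \<sigma> ` \<Gamma>))"
      using infd_sequent[OF IH(2)[OF s]] by (intro infd_weaken[OF IH(2)[OF s]]) auto
  qed auto
  then show ?case by blast
qed


section \<open>Progressivity\<close>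

text \<open>Applied to \<open>X t\<close>, rule \<open>prog\<close> adds \<open>X s\<close> for each
  \<open>s\<close> below \<open>t\<close>. The negated hypothesis of progressivity, taken at
  \<open>s\<close>, splits into a true instance of \<open>L\<close> and the negation of
  \<open>X s\<close>. The summand 6 counts the conjunction, the existential, \<open>prog\<close>,
  two steps for the disjunction and the universal quantifier.\<close>

lemma infd_Prog:
  assumes L: "PA_fm L" "fv L \<subseteq> {0, 1}" and "Prog L \<in> \<Gamma>" "sequent \<Gamma>"
  shows "infd (defined_rel L) (fin (rk L + 6)) d \<Gamma>"
proof -
  let ?body = "Imp (All (Imp L (Pos (InX v0)))) (Pos (InX v0))"
  \<comment> \<open>\<open>?ex t\<close> negates the hypothesis that \<open>X\<close> holds below
    \<open>t\<close>; under its binder \<open>t\<close> replaces index 1.\<close>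
  let ?ex = "\<lambda>t. Ex (And (subst (up (case_nat t Var)) L) (Neg (InX v0)))"
  have body: "inst ?body t = Or (?ex t) (Pos (InX t))" for t
    by (simp add: inst_def Imp_def up_def)
  have "infd (defined_rel L) (fin (rk L + 5)) d (insert (inst ?body t) \<Gamma>)"
    if t: "closed_tm t" for t
  proof -
    let ?\<Gamma> = "insert (?ex t) (insert (Pos (InX t)) (insert (inst ?body t) \<Gamma>))"
    have "sentence (inst ?body t)"
      using assms(3,4) by (intro sentence_inst[OF t]) (auto simp: sequent_def Prog_def)
    then have sq: "sequent ?\<Gamma>" using assms(4) t by (auto simp: body sequent_def sentence_def)
    have "infd (defined_rel L) (fin (rk L + 3)) d ?\<Gamma>"
    proof (rule infd_progI[OF sq])
      show "Pos (InX t) \<in> ?\<Gamma>" by simp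
      fix s assume s: "closed_tm s" and less: "defined_rel L (val s) (val t)"
      let ?\<sigma> = "case_nat s (case_nat t Var)"
      let ?\<Delta> = "insert (And (subst ?\<sigma> L) (Neg (InX s))) (insert (Pos (InX s)) ?\<Gamma>)"
      have "sentence (subst ?\<sigma> L)"
        using L(2) s t by (fastforce simp: sentence_def fv_subst closed_tm_def split: nat.split)
      then have sq': "sequent ?\<Delta>" "sequent (insert (subst ?\<sigma> L) ?\<Delta>)" "sequent (insert (Neg (InX s)) ?\<Delta>)"
        using sq s by (auto simp: sentence_def closed_tm_def)
      \<comment> \<open>The environments may differ beyond index 1, where \<open>L\<close> has no
        free variables.\<close>
      have "sat {} (\<lambda>n. eval (\<lambda>_. 0) (?\<sigma> n)) L = sat {} (case_nat (val s) (\<lambda>_. val t)) L"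
        by (rule sat_cong) (use L(2) in \<open>auto simp: val_def\<close>)
      then have "sat {} (\<lambda>_. 0) (subst ?\<sigma> L)"
        using less by (simp add: sat_subst defined_rel_def)
      then have "infd (defined_rel L) (fin (rk (subst ?\<sigma> L))) d (insert (subst ?\<sigma> L) ?\<Delta>)"
        by (intro infd_true) (use L sq' in auto)
      moreover have "infd (defined_rel L) (fin 0) d (insert (Neg (InX s)) ?\<Delta>)"
        by (rule infd.X_lit[OF sq'(3), of s s]) auto
      ultimately have "infd (defined_rel L) (fin (rk L + 1)) d ?\<Delta>"
        by (rule infd_conjI[rotated]) auto
      moreover have "inst (And (subst (up (case_nat t Var)) L) (Neg (InX v0))) s
          = And (subst ?\<sigma> L) (Neg (InX s))"
        using inst_subst_up[of "case_nat t Var" L s] by (simp add: inst_def)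
      ultimately have "infd (defined_rel L) (fin (rk L + 1)) d
          (insert (inst (And (subst (up (case_nat t Var)) L) (Neg (InX v0))) s)
            (insert (Pos (InX s)) ?\<Gamma>))"
        by simp
      then show "infd (defined_rel L) (fin (rk L + 2)) d (insert (Pos (InX s)) ?\<Gamma>)"
        by (rule infd_exI[rotated 2]) (use s in auto)
    qed simp
    then show ?thesis
      by (rule infd_disjI[rotated, where \<gamma> = "fin (rk L + 4)"]) (auto simp: body)
  qed
  then show ?thesis
    by (rule infd_allI[rotated]) (use assms(3) in \<open>simp_all add: Prog_def\<close>)
qed

lemma sentence_Prog: "fv L \<subseteq> {0, 1} \<Longrightarrow> sentence (Prog L)"
  by (auto simp: Prog_def sentence_def Imp_def)

text \<open>\<open>TI L\<close> is cut against its negation, a conjunction of \<open>Prog L\<close>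
  and the existence of a number outside \<open>X\<close>. The first conjunct is derivable, and the
  second, taken at \<open>t\<close>, clashes with \<open>X t\<close>. All bounds are independent of
  \<open>t\<close>.\<close>

lemma provable_TI_imp_infd:
  assumes L: "PA_fm L" "fv L \<subseteq> {0, 1}" and prov: "provable PAX (TI L)"
  shows "\<exists>\<alpha>::'e. \<exists>d. \<forall>t. closed_tm t \<longrightarrow> infd (defined_rel L) \<alpha> d {Pos (InX t)}"
proof -
  let ?R = "defined_rel L"
  let ?all = "All (Pos (InX v0))"
  from fol_derivable_imp_infd[OF prov[unfolded provable_def]] obtain k d where
    kd: "\<And>\<sigma>. closed_sub \<sigma> \<Longrightarrow> infd ?R (lim k) d (subst \<sigma> ` {TI L})" by blast
  have all: "sentence ?all" and prog: "sentence (Prog L)" and TI: "sentence (TI L)"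
    using sentence_Prog[OF L(2)] by (auto simp: sentence_def TI_def Imp_def)
  have "subst (\<lambda>_. Zero) (TI L) = subst Var (TI L)"
    using TI by (intro subst_cong) (auto simp: sentence_def)
  then have TI_d: "infd ?R (lim k) d {TI L}"
    using kd[of "\<lambda>_. Zero"] by (simp add: closed_sub_def)
  define e where "e = max d (Suc (rk (TI L)))"
  have "infd ?R (lim (k + 3)) e {Pos (InX t)}" if t: "closed_tm t" for t
  proof (rule infd_cutI)
    show "infd ?R (lim k) e (insert (TI L) {Pos (InX t)})"
      by (rule infd_weaken[OF TI_d]) (use TI t in \<open>auto simp: e_def\<close>)
    have neg_TI: "neg (TI L) = And (Prog L) (Ex (Neg (InX v0)))"
      by (simp add: TI_def Imp_def)
    show "infd ?R (lim (k + 1)) e (insert (neg (TI L)) {Pos (InX t)})"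
    proof (rule infd_conjI)
      show "And (Prog L) (Ex (Neg (InX v0))) \<in> insert (neg (TI L)) {Pos (InX t)}"
        by (simp add: neg_TI)
      have sq: "sequent (insert (neg (TI L)) {Pos (InX t)})" using TI t by simp
      show "infd ?R (fin (rk L + 6)) e (insert (Prog L) (insert (neg (TI L)) {Pos (InX t)}))"
        by (rule infd_Prog[OF L]) (use sq prog in auto)
      show "infd ?R (fin 1) e (insert (Ex (Neg (InX v0))) (insert (neg (TI L)) {Pos (InX t)}))"
      proof (rule infd_exI[OF _ t])
        show "infd ?R (fin 0) e (insert (inst (Neg (InX v0)) t)
            (insert (Ex (Neg (InX v0))) (insert (neg (TI L)) {Pos (InX t)})))"
          by (rule infd.X_lit[of _ t t])
            (use sq t all in \<open>auto simp: inst_def sentence_def\<close>)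
      qed auto
    qed auto
  qed (auto simp: e_def)
  then show ?thesis by blast
qed

end


section \<open>Boundedness\<close>

text \<open>For a well order \<open>R\<close>: the order type of the predecessors of
  \<open>n\<close> is at most that of the elements below \<open>\<gamma>\<close>.\<close>

definition segment_bound :: "(nat \<Rightarrow> nat \<Rightarrow> bool) \<Rightarrow> nat \<Rightarrow> 'e::wellorder \<Rightarrow> bool" where
  "segment_bound R n \<gamma> \<longleftrightarrow> order_embeds {m. R m n} R {\<delta>. \<delta> < \<gamma>} (<)"

text \<open>An embedding \<open>h\<close> for \<open>n\<close> sends the predecessors of
  \<open>m\<close> below \<open>h m\<close>, and \<open>h m\<close> is below
  \<open>\<gamma>\<close>.\<close>

lemma segment_bound_descend:
  assumes "transp R" "segment_bound R n \<gamma>" "R m n"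
  shows "\<exists>\<delta><\<gamma>. segment_bound R m \<delta>"
proof -
  obtain h where h: "h ` {m. R m n} \<subseteq> {\<delta>. \<delta> < \<gamma>}" "monotone_on {m. R m n} R (<) h"
    using assms(2) by (auto simp: segment_bound_def order_embeds_def)
  have "segment_bound R m (h m)"
    unfolding segment_bound_def order_embeds_def
  proof (intro exI conjI)
    show "h ` {l. R l m} \<subseteq> {\<delta>. \<delta> < h m}" "monotone_on {l. R l m} R (<) h"
      using h(2) assms(3) transpD[OF assms(1) _ assms(3)] by (auto simp: monotone_on_def)
  qed
  then show ?thesis using h(1) assms(3) by blast
qed

text \<open>Least bounds increase strictly along \<open>R\<close>, since a bound for a number yields
  a smaller one for each predecessor. \<open>A\<close> is either the predecessors of one number or
  all numbers.\<close>

lemma order_embeds_if_segments_bounded: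
  fixes \<alpha> :: "'e::wellorder"
  assumes "transp R" "\<And>n. n \<in> A \<Longrightarrow> \<exists>\<beta><\<alpha>. segment_bound R n \<beta>"
  shows "order_embeds A R {\<gamma>. \<gamma> < \<alpha>} (<)"
proof -
  define g :: "nat \<Rightarrow> 'e" where "g n = (LEAST \<gamma>. segment_bound R n \<gamma>)" for n
  have "g n < \<alpha>" if "n \<in> A" for n
    using assms(2)[OF that] Least_le[of "segment_bound R n"] unfolding g_def by (meson le_less_trans)
  moreover have "g m < g n" if "n \<in> A" "R m n" for m n
  proof -
    have "segment_bound R n (g n)"
      using assms(2)[OF that(1)] unfolding g_def by (blast intro: LeastI)
    from segment_bound_descend[OF assms(1) this that(2)] show ?thesis
      using Least_le[of "segment_bound R m"] unfolding g_def by (meson le_less_trans)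
  qed
  ultimately show ?thesis
    unfolding order_embeds_def by (intro exI[of _ g]) (auto simp: monotone_on_def)
qed

text \<open>Sets of formulas \<open>X t\<close> are treated because \<open>prog\<close> keeps the
  old formulas beside the new one, and it is open which of them a premise bounds.\<close>

lemma boundedness:
  fixes \<alpha> :: "'e::wellorder"
  assumes "transp R" "infd R \<alpha> 0 \<Gamma>" "\<Gamma> \<subseteq> range (\<lambda>t. Pos (InX t))"
  shows "\<exists>t. Pos (InX t) \<in> \<Gamma> \<and> segment_bound R (val t) \<alpha>"
  using assms(2,3)
proof (induction \<alpha> arbitrary: \<Gamma> rule: less_induct)
  case (less \<alpha>)
  from less.prems(1) show ?case
  proof cases
    case (true_lit \<phi>)
    then show ?thesis using less.prems(2) by (auto simp: true_PA_literal_def)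
  next
    case (prog t)
    \<comment> \<open>Either a formula of \<open>\<Gamma>\<close> has a bound below
      \<open>\<alpha>\<close>, which can be enlarged, or every premise must bound its new
      formula.\<close>
    show ?thesis
    proof (cases "\<exists>u. Pos (InX u) \<in> \<Gamma> \<and> (\<exists>\<beta><\<alpha>. segment_bound R (val u) \<beta>)")
      case True
      then obtain u \<beta> h where u: "Pos (InX u) \<in> \<Gamma>" "\<beta> < \<alpha>"
        and h: "h ` {m. R m (val u)} \<subseteq> {\<delta>. \<delta> < \<beta>}" "monotone_on {m. R m (val u)} R (<) h"
        by (auto simp: segment_bound_def order_embeds_def)
      from h(1) u(2) have "h ` {m. R m (val u)} \<subseteq> {\<delta>. \<delta> < \<alpha>}" by fastforce
      with u(1) h(2) show ?thesis by (auto simp: segment_bound_def order_embeds_def)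
    next
      case False
      have "\<exists>\<beta><\<alpha>. segment_bound R n \<beta>" if "R n (val t)" for n
      proof -
        \<comment> \<open>The numeral selects the premise for the predecessor \<open>n\<close>; its
          cut rank is again 0.\<close>
        from prog(3) that obtain \<beta> \<Delta> where \<beta>: "\<beta> < \<alpha>"
          "\<Delta> \<subseteq> insert (Pos (InX (numeral_tm n))) \<Gamma>" "infd R \<beta> 0 \<Delta>"
          by (metis closed_numeral_tm le_zero_eq val_numeral_tm)
        then have "\<Delta> \<subseteq> range (\<lambda>t. Pos (InX t))" using less.prems(2) by auto
        from less.IH[OF \<beta>(1,3) this] obtain u where
          u: "Pos (InX u) \<in> \<Delta>" "segment_bound R (val u) \<beta>" by blast
        with False \<beta>(1,2) have "u = numeral_tm n" by auto
        with u \<beta>(1) show ?thesis by auto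
      qed
      then have "segment_bound R (val t) \<alpha>"
        by (subst segment_bound_def) (intro order_embeds_if_segments_bounded[OF assms(1)], auto)
      then show ?thesis using prog by blast
    qed
  \<comment> \<open>The other rules need a formula of a different shape or a cut formula of rank
    below 0.\<close>
  qed (use less.prems(2) in auto)
qed

text \<open>At a least counterexample, \<open>h x < x\<close> gives \<open>h (h x) < h x\<close>,
  against minimality.\<close>

lemma strict_mono_ge_self:
  fixes h :: "'e::wellorder \<Rightarrow> 'e"
  assumes "\<And>x y. x < y \<Longrightarrow> h x < h y"
  shows "x \<le> h x"
proof (induction x rule: less_induct)
  case (less x)
  show ?case
  proof (rule ccontr)
    assume "\<not> x \<le> h x"
    then have "h x < x" by simp
    with less[OF this] assms[OF this] show False by simp
  qed
qed

theorem theorem3p12: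
  fixes succ :: "'e::wellorder \<Rightarrow> 'e" and zero omega :: 'e
    and L :: fm
    and f :: "'e \<times> nat \<Rightarrow> 'e"
  assumes succ_gt: "\<And>\<alpha>. \<alpha> < succ \<alpha>"
    and zero_less_omega: "zero < omega"
    and omega_limit: "\<And>\<alpha>. \<alpha> < omega \<Longrightarrow> succ \<alpha> < omega"
    and L_PA: "PA_fm L"
    and L_fv: "fv L \<subseteq> {0, 1}"
    and L_wo: "strict_well_order (defined_rel L)"
    and cut_elim: "\<And>\<alpha> d \<Gamma>. sequent \<Gamma> \<Longrightarrow> infd (defined_rel L) \<alpha> d \<Gamma>
                     \<Longrightarrow> infd (defined_rel L) (f (\<alpha>, d)) 0 \<Gamma>"
  shows "(provable PAX (TI L) \<longrightarrow>
            (\<exists>\<alpha>::'e. order_embeds UNIV (defined_rel L) {\<gamma>. \<gamma> < \<alpha>} (<)))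
       \<and> (order_embeds (UNIV :: 'e set) (<) UNIV (defined_rel L) \<longrightarrow>
            \<not> provable PAX (TI L))"
proof -
  interpret heights succ zero omega
    by unfold_locales (fact succ_gt zero_less_omega omega_limit)+
  have trans: "transp (defined_rel L)" using L_wo by (simp add: strict_well_order_def)
  have embeds: "\<exists>\<alpha>::'e. order_embeds UNIV (defined_rel L) {\<gamma>. \<gamma> < \<alpha>} (<)"
    if prov: "provable PAX (TI L)"
  proof -
    obtain \<alpha> :: 'e and d where
      \<alpha>: "\<And>t. closed_tm t \<Longrightarrow> infd (defined_rel L) \<alpha> d {Pos (InX t)}"
      using provable_TI_imp_infd[OF L_PA L_fv prov] by blast
    have "segment_bound (defined_rel L) n (f (\<alpha>, d))" for n
    proof -
      \<comment> \<open>The new height depends only on \<open>\<alpha>\<close> and \<open>d\<close>,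
        so it is the same for all \<open>n\<close>.\<close>
      have "infd (defined_rel L) (f (\<alpha>, d)) 0 {Pos (InX (numeral_tm n))}"
        by (rule cut_elim) (simp_all add: \<alpha>)
      from boundedness[OF trans this] show ?thesis by simp
    qed
    \<comment> \<open>The bounds must lie strictly below the target, hence the successor.\<close>
    then show ?thesis
      using order_embeds_if_segments_bounded[OF trans, of UNIV "succ (f (\<alpha>, d))"] succ_gt by blast
  qed
  moreover have "\<not> provable PAX (TI L)"
    if emb: "order_embeds (UNIV :: 'e set) (<) UNIV (defined_rel L)"
  proof
    assume "provable PAX (TI L)"
    from embeds[OF this] obtain \<alpha> :: 'e and g where
      g: "range g \<subseteq> {\<gamma>. \<gamma> < \<alpha>}" "monotone (defined_rel L) (<) g"
      by (auto simp: order_embeds_def)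
    obtain h :: "'e \<Rightarrow> nat" where h: "monotone (<) (defined_rel L) h"
      using emb by (auto simp: order_embeds_def)
    \<comment> \<open>The composition is a strictly increasing map from the whole well order into
      its elements below \<open>\<alpha>\<close>, which is impossible.\<close>
    have "\<alpha> \<le> g (h \<alpha>)"
      by (rule strict_mono_ge_self[of "\<lambda>x. g (h x)"]) (use g(2) h in \<open>auto dest: monotoneD\<close>)
    moreover have "g (h \<alpha>) < \<alpha>" using g(1) by blast
    ultimately show False by simp
  qed
  ultimately show ?thesis by blast
qed

end
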